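(* Let $n\ge 2$, $G=\mathbb{R}^n\setminus\{0\}$, $x\in G$, $r\in(0,\pi]$, and $m\in\{j,k,|\cdot|,p,q,s\}$. Then there exists a best possible radius $t>0$ such that $B_m(x,t)\subset B_v(x,r)$; that is, there is $t>0$ with $B_m(x,t)\subset B_v(x,r)$ and $B_m(x,t')\not\subset B_v(x,r)$ for every $t'>t$.
   Context: Here $G=\mathbb{R}^n\setminus\{0\}$, so $\partial G=\{0\}$ and $d(x)=d(x,\partial G)=|x|$. For a function $m$ on pairs of points of $G$, $B_m(x,t)=\{y\in G: m(x,y)<t\}$. The functions are, for $x,y\in G$: - visual angle: $v(x,y)=\sup\{\measuredangle(x,z,y): z\in\partial G\}=\measuredangle(x,0,y)\in[0,\pi]$, the angle between the segments $[x,0]$ and $[y,0]$; - distance ratio metric: $j(x,y)=\log\left(1+\frac{|x-y|}{\min\{|x|,|y|\}}\right)$; - quasihyperbolic metric: $k(x,y)=\inf_\gamma\int_\gamma\frac{|dz|}{|z|}$, the infimum over all rectifiable arcs $\gamma$ joining $x$ to $y$ in $G$; - Euclidean metric: $|\cdot|$, i.e. $m(x,y)=|x-y|$; - point pair function: $p(x,y)=\frac{|x-y|}{\sqrt{|x-y|^2+4|x||y|}}$; - chordal metric: $q(x,y)=\frac{|x-y|}{\sqrt{1+|x|^2}\sqrt{1+|y|^2}}$; - triangular ratio metric: $s(x,y)=\frac{|x-y|}{|x|+|y|}$. *)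

theory Defs
  imports "HOL-Analysis.Analysis"
begin

definition punctured_space :: "'a::real_normed_vector set" where
  "punctured_space = UNIV - {0}"

definition m_ball :: "('a::real_normed_vector \<Rightarrow> 'a \<Rightarrow> real) \<Rightarrow> 'a \<Rightarrow> real \<Rightarrow> 'a set" where
  "m_ball m x t = {y \<in> punctured_space. m x y < t}"

text \<open>The angle between the segments \<open>[z, x]\<close> and \<open>[z, y]\<close>, with vertex \<open>z\<close> in the middle.\<close>

definition vertex_angle :: "'a::real_inner \<Rightarrow> 'a \<Rightarrow> 'a \<Rightarrow> real" where
  "vertex_angle x z y = arccos (((x - z) \<bullet> (y - z)) / (norm (x - z) * norm (y - z)))"

definition visual_angle :: "'a::real_inner \<Rightarrow> 'a \<Rightarrow> real" where
  "visual_angle x y = (SUP z\<in>frontier punctured_space. vertex_angle x z y)"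

definition distance_ratio :: "'a::real_normed_vector \<Rightarrow> 'a \<Rightarrow> real" where
  "distance_ratio x y = ln (1 + norm (x - y) / min (norm x) (norm y))"

definition inscribed_lengths :: "(real \<Rightarrow> 'a::real_normed_vector) \<Rightarrow> real \<Rightarrow> real \<Rightarrow> real set" where
  "inscribed_lengths \<gamma> a b =
     {(\<Sum>i<N. norm (\<gamma> (\<tau> (Suc i)) - \<gamma> (\<tau> i))) | (N::nat) (\<tau>::nat \<Rightarrow> real).
        \<tau> 0 = a \<and> \<tau> N = b \<and> (\<forall>i<N. \<tau> i \<le> \<tau> (Suc i))}"

definition rectifiable_arc :: "(real \<Rightarrow> 'a::real_normed_vector) \<Rightarrow> bool" where
  "rectifiable_arc \<gamma> \<longleftrightarrow> arc \<gamma> \<and> bdd_above (inscribed_lengths \<gamma> 0 1)"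

text \<open>The supremum is meaningful only on subintervals of \<open>[0, 1]\<close> and for rectifiable \<open>\<gamma>\<close>.\<close>

definition curve_length :: "(real \<Rightarrow> 'a::real_normed_vector) \<Rightarrow> real \<Rightarrow> real \<Rightarrow> real" where
  "curve_length \<gamma> a b = Sup (inscribed_lengths \<gamma> a b)"

text \<open>The integral of \<open>f\<close> along \<open>\<gamma>\<close> with respect to arc length, \<open>|dz|\<close> being the
  Lebesgue--Stieltjes measure of the length function of \<open>\<gamma>\<close>. The length function is
  extended from \<open>[0, 1]\<close> to the real line by constants, so no mass lies outside \<open>[0, 1]\<close>.\<close>

definition arclength_integral ::
  "(real \<Rightarrow> 'a::real_normed_vector) \<Rightarrow> ('a \<Rightarrow> real) \<Rightarrow> real" where
  "arclength_integral \<gamma> f =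
     (LINT t:{0..1}|interval_measure (\<lambda>t. curve_length \<gamma> 0 (max 0 (min 1 t))). f (\<gamma> t))"

text \<open>The library predicate \<open>arc\<close> demands injectivity on \<open>[0, 1]\<close>, so no arc joins a point
  to itself. The case \<open>x = y\<close>, where only the degenerate one-point arc joins the two
  points, is therefore separate.\<close>

definition quasihyperbolic :: "'a::real_normed_vector \<Rightarrow> 'a \<Rightarrow> real" where
  "quasihyperbolic x y =
     (if x = y then 0
      else (INF \<gamma> \<in> {\<gamma>. rectifiable_arc \<gamma> \<and> path_image \<gamma> \<subseteq> punctured_space \<and>
                         pathstart \<gamma> = x \<and> pathfinish \<gamma> = y}.
              arclength_integral \<gamma> (\<lambda>z. 1 / norm z)))"

definition point_pair :: "'a::real_normed_vector \<Rightarrow> 'a \<Rightarrow> real" where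
  "point_pair x y = norm (x - y) / sqrt ((norm (x - y))\<^sup>2 + 4 * norm x * norm y)"

definition chordal :: "'a::real_normed_vector \<Rightarrow> 'a \<Rightarrow> real" where
  "chordal x y = norm (x - y) / (sqrt (1 + (norm x)\<^sup>2) * sqrt (1 + (norm y)\<^sup>2))"

definition triangular_ratio :: "'a::real_normed_vector \<Rightarrow> 'a \<Rightarrow> real" where
  "triangular_ratio x y = norm (x - y) / (norm x + norm y)"

end

theory Submission
  imports Defs
begin

text \<open>The supremum of the admissible radii is itself admissible, since a ball is the union of the
  smaller concentric balls. It is finite because the visual angle of \<open>x\<close> and \<open>- x\<close> is
  \<open>pi\<close>, and positive because the visual angle is continuous at \<open>x\<close> and every \<open>m x y\<close> is
  bounded away from 0 outside a Euclidean ball about \<open>x\<close>. For the quasihyperbolic metric the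
  latter requires the arc length function to be right-continuous: otherwise
  \<open>interval_measure\<close> is a junk value. It also requires an arc between any two points of the
  punctured space, the infimum of an empty set of reals being a junk value.\<close>

section \<open>The visual angle with the single boundary point 0\<close>

lemma visual_angle_eq:
  fixes x y :: "'a::euclidean_space"
  shows "visual_angle x y = arccos ((x \<bullet> y) / (norm x * norm y))"
proof -
  have "frontier (punctured_space :: 'a set) = {0}"
    using frontier_complement[of "{0::'a}"]
    by (simp add: punctured_space_def frontier_def Compl_eq_Diff_UNIV)
  then show ?thesis
    by (simp add: visual_angle_def vertex_angle_def)
qed

lemma visual_angle_minus:
  fixes x :: "'a::euclidean_space"
  assumes "x \<noteq> 0"
  shows "visual_angle x (-x) = pi"
  using assms by (simp add: visual_angle_eq dot_square_norm power2_eq_square)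

text \<open>The cosine of the angle is continuous at \<open>x\<close> with value 1 there, and 1
  exceeds \<open>cos r\<close>; since \<open>arccos\<close> is decreasing, the angle stays below
  \<open>r\<close> nearby.\<close>

lemma visual_angle_less_near:
  fixes x :: "'a::euclidean_space"
  assumes "x \<noteq> 0" "0 < r" "r \<le> pi"
  obtains d where "0 < d" "\<And>y. norm (x - y) < d \<Longrightarrow> visual_angle x y < r"
proof -
  let ?c = "\<lambda>y. (x \<bullet> y) / (norm x * norm y)"
  have "isCont ?c x"
    using assms by (intro continuous_intros) auto
  moreover have "?c x = 1"
    using assms by (simp add: dot_square_norm power2_eq_square)
  \<comment> \<open>The limit is taken along \<open>nhds x\<close> and not \<open>at x\<close>, so
    that the resulting ball contains \<open>x\<close> itself.\<close>
  ultimately have "(?c \<longlongrightarrow> 1) (nhds x)"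
    using tendsto_at_iff_tendsto_nhds[of ?c x] by (simp only: isCont_def)
  moreover have "cos r < 1"
    using cos_monotone_0_pi[of 0 r] assms by simp
  ultimately have "\<forall>\<^sub>F y in nhds x. cos r < ?c y"
    by (rule order_tendstoD)
  then obtain d where d: "0 < d" "\<And>y. dist y x < d \<Longrightarrow> cos r < ?c y"
    unfolding eventually_nhds_metric by blast
  have "visual_angle x y < r" if "norm (x - y) < d" for y
  proof -
    \<comment> \<open>This covers \<open>y = 0\<close> as well, where the denominator vanishes and
      the quotient is 0.\<close>
    have "?c y \<le> 1"
      by (intro divide_le_eq_1[THEN iffD2]) (use norm_cauchy_schwarz[of x y] \<open>x \<noteq> 0\<close> in force)
    moreover have "cos r < ?c y"
      using d(2)[of y] that by (metis dist_norm norm_minus_commute)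
    ultimately have "arccos (?c y) < arccos (cos r)"
      by (intro arccos_less_arccos cos_ge_minus_one)
    then show ?thesis
      using assms by (simp add: visual_angle_eq arccos_cos)
  qed
  with d(1) show ?thesis by (rule that)
qed

section \<open>The arc length function\<close>

lemma inscribed_lengthsI:
  assumes "\<tau> 0 = a" "\<tau> N = b" "\<And>i. i < N \<Longrightarrow> \<tau> i \<le> \<tau> (Suc i)"
  shows "(\<Sum>i<N. norm (\<gamma> (\<tau> (Suc i)) - \<gamma> (\<tau> i))) \<in> inscribed_lengths \<gamma> a b"
  using assms unfolding inscribed_lengths_def by blast

lemma inscribed_lengthsE:
  assumes "u \<in> inscribed_lengths \<gamma> a b"
  obtains N \<tau> where "u = (\<Sum>i<N. norm (\<gamma> (\<tau> (Suc i)) - \<gamma> (\<tau> i)))" "\<tau> 0 = a" "\<tau> N = b"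
    "\<And>i. i < N \<Longrightarrow> \<tau> i \<le> \<tau> (Suc i)"
  using assms unfolding inscribed_lengths_def by blast

lemma partition_mono:
  fixes \<tau> :: "nat \<Rightarrow> real"
  assumes "\<And>i. i < N \<Longrightarrow> \<tau> i \<le> \<tau> (Suc i)" "i \<le> j" "j \<le> N"
  shows "\<tau> i \<le> \<tau> j"
  using assms(2,3)
proof (induction rule: dec_induct)
  case (step n)
  then show ?case using assms(1)[of n] by simp
qed simp

lemma inscribed_lengths_nonneg: "u \<in> inscribed_lengths \<gamma> a b \<Longrightarrow> 0 \<le> u"
  by (auto simp: inscribed_lengths_def intro: sum_nonneg)

text \<open>Besides bounding chords by the length, this shows that the set is non-empty, as suprema
  of reals require.\<close>

lemma chord_in_inscribed_lengths:
  "a \<le> b \<Longrightarrow> norm (\<gamma> b - \<gamma> a) \<in> inscribed_lengths \<gamma> a b"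
  using inscribed_lengthsI[of "\<lambda>i. if i = 0 then a else b" a 1 b \<gamma>] by simp

lemma inscribed_lengths_concat:
  assumes "u \<in> inscribed_lengths \<gamma> a b" "v \<in> inscribed_lengths \<gamma> b c"
  shows "u + v \<in> inscribed_lengths \<gamma> a c"
proof -
  obtain N \<tau> where u: "u = (\<Sum>i<N. norm (\<gamma> (\<tau> (Suc i)) - \<gamma> (\<tau> i)))" "\<tau> 0 = a" "\<tau> N = b"
    "\<And>i. i < N \<Longrightarrow> \<tau> i \<le> \<tau> (Suc i)"
    using assms(1) by (blast elim: inscribed_lengthsE)
  obtain M \<sigma> where v: "v = (\<Sum>i<M. norm (\<gamma> (\<sigma> (Suc i)) - \<gamma> (\<sigma> i)))" "\<sigma> 0 = b" "\<sigma> M = c"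
    "\<And>i. i < M \<Longrightarrow> \<sigma> i \<le> \<sigma> (Suc i)"
    using assms(2) by (blast elim: inscribed_lengthsE)
  \<comment> \<open>At index \<open>N\<close> both partitions have the value \<open>b\<close>, so
    either formula is valid there.\<close>
  define \<rho> where "\<rho> i = (if i < N then \<tau> i else \<sigma> (i - N))" for i
  have lo: "\<rho> i = \<tau> i" if "i \<le> N" for i
    using that u(3) v(2) by (auto simp: \<rho>_def)
  have hi: "\<rho> (N + i) = \<sigma> i" for i
    by (simp add: \<rho>_def)
  have "\<rho> i \<le> \<rho> (Suc i)" if "i < N + M" for i
  proof (cases "i < N")
    case True
    then show ?thesis using u(4) by (simp add: lo)
  next
    case False
    then obtain k where "i = N + k" by (metis le_Suc_ex not_less)
    then show ?thesis using v(4)[of k] that hi[of k] hi[of "Suc k"] by simp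
  qed
  then have "(\<Sum>i<N+M. norm (\<gamma> (\<rho> (Suc i)) - \<gamma> (\<rho> i))) \<in> inscribed_lengths \<gamma> a c"
    using lo[of 0] u(2) hi[of M] v(3) by (intro inscribed_lengthsI) auto
  moreover have "(\<Sum>i<N+M. norm (\<gamma> (\<rho> (Suc i)) - \<gamma> (\<rho> i))) =
      (\<Sum>i<N. norm (\<gamma> (\<rho> (Suc i)) - \<gamma> (\<rho> i))) +
      (\<Sum>i<M. norm (\<gamma> (\<rho> (Suc (N + i))) - \<gamma> (\<rho> (N + i))))"
    by (induction M) (simp_all add: add.assoc)
  moreover have "(\<Sum>i<N. norm (\<gamma> (\<rho> (Suc i)) - \<gamma> (\<rho> i))) = u"
    unfolding u(1) by (intro sum.cong) (auto simp: lo)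
  moreover have "(\<Sum>i<M. norm (\<gamma> (\<rho> (Suc (N + i))) - \<gamma> (\<rho> (N + i)))) = v"
    unfolding v(1) by (intro sum.cong) (auto simp: hi simp flip: add_Suc_right)
  ultimately show ?thesis by simp
qed

text \<open>Adding the chords over \<open>[a, c]\<close> and \<open>[d, b]\<close> turns an
  inscribed length of \<open>[c, d]\<close> into one of \<open>[a, b]\<close> that is at least as
  large.\<close>

lemma bdd_above_inscribed_lengths:
  assumes "bdd_above (inscribed_lengths \<gamma> a b)" "a \<le> c" "c \<le> d" "d \<le> b"
  shows "bdd_above (inscribed_lengths \<gamma> c d)"
proof -
  obtain B where B: "\<And>u. u \<in> inscribed_lengths \<gamma> a b \<Longrightarrow> u \<le> B"
    using assms(1) by (auto simp: bdd_above_def)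
  have "u \<le> B" if "u \<in> inscribed_lengths \<gamma> c d" for u
    using B[OF inscribed_lengths_concat[OF inscribed_lengths_concat[OF
          chord_in_inscribed_lengths[OF assms(2)] that] chord_in_inscribed_lengths[OF assms(4)]]]
      norm_ge_zero[of "\<gamma> c - \<gamma> a"] norm_ge_zero[of "\<gamma> b - \<gamma> d"] by linarith
  then show ?thesis by (auto simp: bdd_above_def)
qed

lemma norm_le_curve_length:
  assumes "bdd_above (inscribed_lengths \<gamma> a b)" "a \<le> b"
  shows "norm (\<gamma> b - \<gamma> a) \<le> curve_length \<gamma> a b"
  unfolding curve_length_def
  using assms by (intro cSup_upper chord_in_inscribed_lengths)

lemma curve_length_refl: "curve_length \<gamma> a a = 0"
proof -
  have "u = 0" if "u \<in> inscribed_lengths \<gamma> a a" for u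
  proof -
    obtain N \<tau> where u: "u = (\<Sum>i<N. norm (\<gamma> (\<tau> (Suc i)) - \<gamma> (\<tau> i)))" "\<tau> 0 = a" "\<tau> N = a"
      "\<And>i. i < N \<Longrightarrow> \<tau> i \<le> \<tau> (Suc i)"
      using \<open>u \<in> _\<close> by (blast elim: inscribed_lengthsE)
    have "\<tau> i = a" if "i \<le> N" for i
      using partition_mono[of N \<tau> 0 i] partition_mono[of N \<tau> i N] u(2-4) that by force
    then show ?thesis by (simp add: u(1))
  qed
  then have "inscribed_lengths \<gamma> a a = {0}"
    using chord_in_inscribed_lengths[of a a \<gamma>] by auto
  then show ?thesis by (simp add: curve_length_def)
qed

text \<open>Inscribed lengths of the two pieces add up to one of the whole. The suprema are taken
  one after the other, first over the right piece with \<open>u\<close> fixed.\<close>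

lemma curve_length_superadditive:
  assumes bdd: "bdd_above (inscribed_lengths \<gamma> a c)" and "a \<le> b" "b \<le> c"
  shows "curve_length \<gamma> a b + curve_length \<gamma> b c \<le> curve_length \<gamma> a c"
proof -
  have *: "u + v \<le> curve_length \<gamma> a c"
    if "u \<in> inscribed_lengths \<gamma> a b" "v \<in> inscribed_lengths \<gamma> b c" for u v
    unfolding curve_length_def
    using inscribed_lengths_concat[OF that] bdd by (intro cSup_upper)
  have "u \<le> curve_length \<gamma> a c - curve_length \<gamma> b c" if u: "u \<in> inscribed_lengths \<gamma> a b" for u
  proof -
    have "curve_length \<gamma> b c \<le> curve_length \<gamma> a c - u"
      unfolding curve_length_def[of \<gamma> b c]
      using chord_in_inscribed_lengths[OF \<open>b \<le> c\<close>, of \<gamma>] *[OF u]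
      by (intro cSup_least) (auto simp: algebra_simps)
    then show ?thesis by simp
  qed
  then have "curve_length \<gamma> a b \<le> curve_length \<gamma> a c - curve_length \<gamma> b c"
    unfolding curve_length_def[of \<gamma> a b]
    using chord_in_inscribed_lengths[OF \<open>a \<le> b\<close>, of \<gamma>] by (intro cSup_least) auto
  then show ?thesis by simp
qed

text \<open>Clamping a partition of \<open>[a, c]\<close> at \<open>b\<close> by \<open>min\<close>
  and \<open>max\<close> yields partitions of both pieces; the repeated points are harmless because
  partitions need only be weakly increasing.\<close>

lemma curve_length_subadditive:
  assumes bdd: "bdd_above (inscribed_lengths \<gamma> a c)" and "a \<le> b" "b \<le> c"
  shows "curve_length \<gamma> a c \<le> curve_length \<gamma> a b + curve_length \<gamma> b c"
proof -
  have bdd1: "bdd_above (inscribed_lengths \<gamma> a b)" and bdd2: "bdd_above (inscribed_lengths \<gamma> b c)"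
    using assms by (auto intro: bdd_above_inscribed_lengths[OF bdd])
  have "u \<le> curve_length \<gamma> a b + curve_length \<gamma> b c" if "u \<in> inscribed_lengths \<gamma> a c" for u
  proof -
    obtain N \<tau> where u: "u = (\<Sum>i<N. norm (\<gamma> (\<tau> (Suc i)) - \<gamma> (\<tau> i)))" "\<tau> 0 = a" "\<tau> N = c"
      "\<And>i. i < N \<Longrightarrow> \<tau> i \<le> \<tau> (Suc i)"
      using \<open>u \<in> _\<close> by (blast elim: inscribed_lengthsE)
    let ?l = "\<lambda>i. min b (\<tau> i)" and ?h = "\<lambda>i. max b (\<tau> i)"
    have "norm (\<gamma> (\<tau> (Suc i)) - \<gamma> (\<tau> i)) \<le>
        norm (\<gamma> (?l (Suc i)) - \<gamma> (?l i)) + norm (\<gamma> (?h (Suc i)) - \<gamma> (?h i))" if i: "i < N" for i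
    proof -
      \<comment> \<open>In the first two cases one clamped chord degenerates to a point. In the
        third the chord straddles \<open>b\<close>, and the triangle inequality through
        \<open>\<gamma> b\<close> splits it.\<close>
      consider "\<tau> (Suc i) \<le> b" "\<tau> i \<le> b" | "b \<le> \<tau> i" "b \<le> \<tau> (Suc i)" | "\<tau> i \<le> b" "b \<le> \<tau> (Suc i)"
        using u(4)[OF i] by linarith
      then show ?thesis
      proof cases
        case 3
        then show ?thesis
          using norm_triangle_ineq[of "\<gamma> b - \<gamma> (\<tau> i)" "\<gamma> (\<tau> (Suc i)) - \<gamma> b"]
          by (simp add: min_def max_def)
      qed (simp_all add: min_absorb1 min_absorb2 max_absorb1 max_absorb2)
    qed
    then have "u \<le> (\<Sum>i<N. norm (\<gamma> (?l (Suc i)) - \<gamma> (?l i))) + (\<Sum>i<N. norm (\<gamma> (?h (Suc i)) - \<gamma> (?h i)))"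
      unfolding u(1) sum.distrib[symmetric] by (intro sum_mono) auto
    moreover have "(\<Sum>i<N. norm (\<gamma> (?l (Suc i)) - \<gamma> (?l i))) \<le> curve_length \<gamma> a b"
      unfolding curve_length_def using u(2-4) assms(2,3)
      by (intro cSup_upper[OF inscribed_lengthsI bdd1]) (auto simp: min_le_iff_disj)
    moreover have "(\<Sum>i<N. norm (\<gamma> (?h (Suc i)) - \<gamma> (?h i))) \<le> curve_length \<gamma> b c"
      unfolding curve_length_def using u(2-4) assms(2,3)
      by (intro cSup_upper[OF inscribed_lengthsI bdd2]) (auto intro: max.coboundedI2)
    ultimately show ?thesis by linarith
  qed
  then show ?thesis
    unfolding curve_length_def[of \<gamma> a c]
    using chord_in_inscribed_lengths[of a c \<gamma>] assms(2,3) by (intro cSup_least) auto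
qed

lemma curve_length_additive:
  assumes "bdd_above (inscribed_lengths \<gamma> a c)" "a \<le> b" "b \<le> c"
  shows "curve_length \<gamma> a c = curve_length \<gamma> a b + curve_length \<gamma> b c"
  using curve_length_subadditive[OF assms] curve_length_superadditive[OF assms] by simp

lemma curve_length_mono:
  assumes "bdd_above (inscribed_lengths \<gamma> a c)" "a \<le> b" "b \<le> c"
  shows "curve_length \<gamma> a b \<le> curve_length \<gamma> a c"
proof -
  have "norm (\<gamma> c - \<gamma> b) \<le> curve_length \<gamma> b c"
    using assms by (intro norm_le_curve_length bdd_above_inscribed_lengths[OF assms(1)]) auto
  then show ?thesis
    using curve_length_additive[OF assms] norm_ge_zero[of "\<gamma> c - \<gamma> b"] by linarith
qed

text \<open>Truncating a fixed partition of \<open>[a, b]\<close> at \<open>s\<close> gives an inscribed length of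
  \<open>[s, b]\<close> that depends continuously on \<open>s\<close>.\<close>

lemma curve_length_tail_lsc:
  assumes cont: "continuous_on {a..b} \<gamma>" and bdd: "bdd_above (inscribed_lengths \<gamma> a b)"
    and "a < b" "0 < e"
  shows "\<forall>\<^sub>F s in at_right a. curve_length \<gamma> a b - e < curve_length \<gamma> s b"
proof -
  obtain u where u: "u \<in> inscribed_lengths \<gamma> a b" "curve_length \<gamma> a b - e < u"
    using less_cSup_iff[OF _ bdd, of "curve_length \<gamma> a b - e"]
      chord_in_inscribed_lengths[of a b \<gamma>] \<open>a < b\<close> \<open>0 < e\<close>
    unfolding curve_length_def by auto
  obtain N \<tau> where \<tau>: "u = (\<Sum>i<N. norm (\<gamma> (\<tau> (Suc i)) - \<gamma> (\<tau> i)))" "\<tau> 0 = a" "\<tau> N = b"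
    "\<And>i. i < N \<Longrightarrow> \<tau> i \<le> \<tau> (Suc i)"
    using u(1) by (blast elim: inscribed_lengthsE)
  have ab: "a \<le> \<tau> i" "\<tau> i \<le> b" if "i \<le> N" for i
    using partition_mono[of N \<tau> 0 i] partition_mono[of N \<tau> i N] \<tau>(2-4) that by auto
  let ?S = "\<lambda>s. \<Sum>i<N. norm (\<gamma> (max s (\<tau> (Suc i))) - \<gamma> (max s (\<tau> i)))"
  have "continuous_on {a..b} ?S"
    using ab \<open>a < b\<close>
    by (intro continuous_intros continuous_on_compose2[OF cont]) auto
  then have "(?S \<longlongrightarrow> ?S a) (at a within {a..b})"
    using \<open>a < b\<close> by (simp add: continuous_on)
  moreover have "?S a = u"
    unfolding \<tau>(1) using ab by (intro sum.cong) (auto simp: max_absorb2)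
  ultimately have "(?S \<longlongrightarrow> u) (at_right a)"
    using \<open>a < b\<close> by (simp add: at_within_Icc_at_right)
  then have "\<forall>\<^sub>F s in at_right a. curve_length \<gamma> a b - e < ?S s"
    using u(2) by (rule order_tendstoD)
  moreover have "\<forall>\<^sub>F s in at_right a. s \<in> {a<..<b}"
    using eventually_at_right_less[of a] eventually_at_right_real[OF \<open>a < b\<close>] by simp
  ultimately show ?thesis
  proof eventually_elim
    case (elim s)
    have "?S s \<in> inscribed_lengths \<gamma> s b"
      using \<tau>(2-4) elim(2) by (intro inscribed_lengthsI) (auto intro: max.coboundedI2)
    then have "?S s \<le> curve_length \<gamma> s b"
      unfolding curve_length_def using elim(2)
      by (intro cSup_upper bdd_above_inscribed_lengths[OF bdd]) auto
    with elim(1) show ?case by simp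
  qed
qed

text \<open>Monotonicity bounds the limit from below. From above, additivity writes the length up to
  \<open>s\<close> as the total minus the tail from \<open>s\<close>, and the tail is lower
  semicontinuous.\<close>

lemma curve_length_right_continuous:
  assumes cont: "continuous_on {a..b} \<gamma>" and bdd: "bdd_above (inscribed_lengths \<gamma> a b)"
    and "a \<le> t" "t < b"
  shows "(curve_length \<gamma> a \<longlongrightarrow> curve_length \<gamma> a t) (at_right t)"
proof (rule order_tendstoI)
  have ev: "\<forall>\<^sub>F s in at_right t. s \<in> {t<..<b}"
    using eventually_at_right_real[OF \<open>t < b\<close>] .
  fix y assume y: "y < curve_length \<gamma> a t"
  show "\<forall>\<^sub>F s in at_right t. y < curve_length \<gamma> a s"
    using ev
  proof eventually_elim
    case (elim s)
    then have "curve_length \<gamma> a t \<le> curve_length \<gamma> a s"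
      using assms by (intro curve_length_mono bdd_above_inscribed_lengths[OF bdd]) auto
    with y show ?case by simp
  qed
next
  have ev: "\<forall>\<^sub>F s in at_right t. s \<in> {t<..<b}"
    using eventually_at_right_real[OF \<open>t < b\<close>] .
  fix y assume y: "curve_length \<gamma> a t < y"
  have "\<forall>\<^sub>F s in at_right t. curve_length \<gamma> t b - (y - curve_length \<gamma> a t) < curve_length \<gamma> s b"
    using assms y
    by (intro curve_length_tail_lsc bdd_above_inscribed_lengths[OF bdd])
       (auto intro: continuous_on_subset[OF cont])
  with ev show "\<forall>\<^sub>F s in at_right t. curve_length \<gamma> a s < y"
  proof eventually_elim
    case (elim s)
    then show ?case
      using curve_length_additive[OF bdd, of s] curve_length_additive[OF bdd, of t] assms(3,4)
      by simp
  qed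
qed

section \<open>The quasihyperbolic metric\<close>

text \<open>The integrator inside \<open>arclength_integral\<close>, named so that its regularity
  can be stated.\<close>

definition length_fun :: "(real \<Rightarrow> 'a::real_normed_vector) \<Rightarrow> real \<Rightarrow> real" where
  "length_fun \<gamma> t = curve_length \<gamma> 0 (max 0 (min 1 t))"

text \<open>Monotonicity and the right continuity proved next are what
  \<open>emeasure_interval_measure_Ioc\<close> requires.\<close>

lemma length_fun_mono:
  assumes "bdd_above (inscribed_lengths \<gamma> 0 1)" "s \<le> t"
  shows "length_fun \<gamma> s \<le> length_fun \<gamma> t"
  unfolding length_fun_def using assms
  by (intro curve_length_mono bdd_above_inscribed_lengths[OF assms(1)]) auto

lemma length_fun_right_continuous:
  assumes "continuous_on {0..1} \<gamma>" "bdd_above (inscribed_lengths \<gamma> 0 1)"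
  shows "continuous (at_right t) (length_fun \<gamma>)"
proof -
  \<comment> \<open>In the first two cases the clamped argument is constant immediately to the right
    of \<open>t\<close>; this includes \<open>t = 1\<close>.\<close>
  consider "t < 0" | "1 \<le> t" | "0 \<le> t" "t < 1" by linarith
  then have "(length_fun \<gamma> \<longlongrightarrow> length_fun \<gamma> t) (at_right t)"
  proof cases
    case 1
    then have "\<forall>\<^sub>F s in at_right t. length_fun \<gamma> s = length_fun \<gamma> t"
      using eventually_at_right_real[of t 0]
      by (auto elim!: eventually_mono simp: length_fun_def)
    then show ?thesis by (rule tendsto_eventually)
  next
    case 2
    then have "\<forall>\<^sub>F s in at_right t. length_fun \<gamma> s = length_fun \<gamma> t"
      using eventually_at_right_less[of t]
      by (auto elim!: eventually_mono simp: length_fun_def)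
    then show ?thesis by (rule tendsto_eventually)
  next
    case 3
    then have "\<forall>\<^sub>F s in at_right t. length_fun \<gamma> s = curve_length \<gamma> 0 s"
      using eventually_at_right_real[of t 1]
      by (auto elim!: eventually_mono simp: length_fun_def)
    moreover have "length_fun \<gamma> t = curve_length \<gamma> 0 t"
      using 3 by (simp add: length_fun_def)
    ultimately show ?thesis
      using curve_length_right_continuous[OF assms 3] by (simp add: tendsto_cong)
  qed
  then show ?thesis by (simp add: continuous_within)
qed

text \<open>Up to the first time \<open>T\<close> at which the arc is at distance \<open>d\<close> from \<open>x\<close> the integrand
  is at least \<open>1 / (norm x + d)\<close>, and the arc has length at least \<open>d\<close> there.\<close>

lemma arclength_integral_lower_bound:
  fixes \<gamma> :: "real \<Rightarrow> 'a::euclidean_space"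
  assumes rect: "rectifiable_arc \<gamma>" and G: "path_image \<gamma> \<subseteq> punctured_space"
    and x: "pathstart \<gamma> = x" and y: "pathfinish \<gamma> = y" and d: "0 < d" "d \<le> norm (x - y)"
  shows "d / (norm x + d) \<le> arclength_integral \<gamma> (\<lambda>z. 1 / norm z)"
proof -
  have cont: "continuous_on {0..1} \<gamma>" and bdd: "bdd_above (inscribed_lengths \<gamma> 0 1)"
    using rect by (auto simp: rectifiable_arc_def arc_def path_def)
  have nz: "\<gamma> t \<noteq> 0" if "t \<in> {0..1}" for t
    using G that by (force simp: path_image_def punctured_space_def)
  have g01: "\<gamma> 0 = x" "\<gamma> 1 = y"
    using x y by (auto simp: pathstart_def pathfinish_def)
  let ?D = "\<lambda>t. norm (\<gamma> t - x)"
  have contD: "continuous_on {0..1} ?D"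
    by (intro continuous_intros cont)
  define E where "E = {t \<in> {0..1}. ?D t = d}"
  have "\<exists>t\<ge>0. t \<le> 1 \<and> ?D t = d"
    using d g01 contD by (intro IVT') (auto simp: norm_minus_commute)
  then have "E \<noteq> {}" by (auto simp: E_def)
  \<comment> \<open>Compactness yields a first time \<open>T\<close> at distance
    \<open>d\<close>.\<close>
  moreover have "compact E"
  proof -
    have "closed E"
      unfolding E_def by (rule continuous_closed_preimage_constant[OF contD]) simp
    moreover have "E = {0..1} \<inter> E" by (auto simp: E_def)
    ultimately show ?thesis by (metis compact_Icc compact_Int_closed)
  qed
  ultimately obtain T where T: "T \<in> E" "\<And>t. t \<in> E \<Longrightarrow> T \<le> t"
    using compact_attains_inf by metis
  then have T01: "0 \<le> T" "T \<le> 1" and TD: "?D T = d" by (auto simp: E_def)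
  have le: "?D t \<le> d" if "0 \<le> t" "t \<le> T" for t
  proof (rule ccontr)
    assume "\<not> ?D t \<le> d"
    \<comment> \<open>The value \<open>d\<close> is already attained at some
      \<open>s \<le> t \<le> T\<close>. Minimality of \<open>T\<close> forces \<open>s = t\<close>,
      where the distance exceeds \<open>d\<close>.\<close>
    then have "\<exists>s\<ge>0. s \<le> t \<and> ?D s = d"
      using d g01 that T01 by (intro IVT' continuous_on_subset[OF contD]) auto
    then obtain s where "0 \<le> s" "s \<le> t" "?D s = d" by blast
    with T(2)[of s] that T01 have "s = t" by (auto simp: E_def)
    with \<open>?D s = d\<close> \<open>\<not> ?D t \<le> d\<close> show False by simp
  qed
  let ?F = "length_fun \<gamma>"
  let ?M = "interval_measure ?F"
  let ?c = "1 / (norm x + d)"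
  have em: "emeasure ?M {a<..b} = ennreal (?F b - ?F a)" if "a \<le> b" for a b
    using that bdd cont
    by (intro emeasure_interval_measure_Ioc) (auto intro: length_fun_mono length_fun_right_continuous)
  have fin: "emeasure ?M {0..1} < \<infinity>"
  proof -
    \<comment> \<open>The measure is known on half-open intervals only, hence the enlargement to the
      left of 0.\<close>
    have "emeasure ?M {0..1} \<le> emeasure ?M {-1<..1}"
      by (intro emeasure_mono) auto
    then show ?thesis by (simp add: em order_le_less_trans)
  qed
  have c0: "0 < ?c" using d by (simp add: add_nonneg_pos)
  have contf: "continuous_on {0..1} (\<lambda>t. 1 / norm (\<gamma> t))"
    using nz by (intro continuous_intros cont) auto
  then have "bounded ((\<lambda>t. 1 / norm (\<gamma> t)) ` {0..1})"
    by (intro compact_imp_bounded compact_continuous_image) auto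
  then obtain B where B: "\<And>t. t \<in> {0..1} \<Longrightarrow> norm (1 / norm (\<gamma> t)) \<le> B"
    unfolding bounded_iff by blast
  \<comment> \<open>A non-integrable function would have integral 0 by default, so the comparison
    below needs integrability; the integrand is bounded and the measure of \<open>{0..1}\<close> is
    finite.\<close>
  have int1: "integrable ?M (\<lambda>t. indicator {0..1} t *\<^sub>R (1 / norm (\<gamma> t)))"
  proof (rule integrableI_bounded_set[where A = "{0..1}" and B = B])
    show "(\<lambda>t. indicator {0..1} t *\<^sub>R (1 / norm (\<gamma> t))) \<in> borel_measurable ?M"
      using borel_measurable_continuous_on_indicator[OF _ contf]
      by (simp cong: measurable_cong_sets)
  qed (use fin B in auto)
  have "emeasure ?M {0<..T} < \<infinity>"
    using em[OF T01(1)] by simp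
  then have int2: "integrable ?M (\<lambda>t. indicator {0<..T} t *\<^sub>R ?c)"
    by (intro integrable_scaleR_left integrable_real_indicator) auto
  \<comment> \<open>The length up to \<open>T\<close> is at least the chord from \<open>x\<close> to
    \<open>\<gamma> T\<close>.\<close>
  have "d \<le> ?F T - ?F 0"
    using norm_le_curve_length[of \<gamma> 0 T] bdd_above_inscribed_lengths[OF bdd, of 0 T] T01 TD g01
    by (simp add: length_fun_def curve_length_refl)
  then have "d * ?c \<le> measure ?M {0<..T} * ?c"
    using c0 d em[OF T01(1)] by (intro mult_right_mono) (auto simp: measure_def)
  also have "\<dots> = (LINT t|?M. indicator {0<..T} t *\<^sub>R ?c)"
    by simp
  also have "\<dots> \<le> (LINT t|?M. indicator {0..1} t *\<^sub>R (1 / norm (\<gamma> t)))"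
  proof (intro integral_mono int1 int2)
    fix t
    have "?c \<le> 1 / norm (\<gamma> t)" if t: "t \<in> {0<..T}"
    proof (rule divide_left_mono)
      show "norm (\<gamma> t) \<le> norm x + d"
        using le[of t] t norm_triangle_sub[of "\<gamma> t" x] by auto
      show "0 < (norm x + d) * norm (\<gamma> t)" using nz[of t] t T01 d by (intro mult_pos_pos add_nonneg_pos) auto
    qed simp
    then show "indicator {0<..T} t *\<^sub>R ?c \<le> indicator {0..1} t *\<^sub>R (1 / norm (\<gamma> t))"
      using T01 by (auto simp: indicator_def)
  qed
  also have "\<dots> = arclength_integral \<gamma> (\<lambda>z. 1 / norm z)"
    by (simp add: arclength_integral_def set_lebesgue_integral_def length_fun_def[abs_def])
  finally show ?thesis by simp
qed

section \<open>Rectifiable arcs avoiding the origin\<close>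

lemma bdd_above_inscribed_lengths_lipschitz:
  assumes "L-lipschitz_on {a..b} \<gamma>"
  shows "bdd_above (inscribed_lengths \<gamma> a b)"
proof -
  have "u \<le> L * (b - a)" if "u \<in> inscribed_lengths \<gamma> a b" for u
  proof -
    obtain N \<tau> where u: "u = (\<Sum>i<N. norm (\<gamma> (\<tau> (Suc i)) - \<gamma> (\<tau> i)))" "\<tau> 0 = a" "\<tau> N = b"
      "\<And>i. i < N \<Longrightarrow> \<tau> i \<le> \<tau> (Suc i)"
      using \<open>u \<in> _\<close> by (blast elim: inscribed_lengthsE)
    have ab: "\<tau> i \<in> {a..b}" if "i \<le> N" for i
      using partition_mono[of N \<tau> 0 i] partition_mono[of N \<tau> i N] u(2-4) that by auto
    have "u \<le> (\<Sum>i<N. L * (\<tau> (Suc i) - \<tau> i))"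
      unfolding u(1)
    proof (rule sum_mono)
      fix i assume "i \<in> {..<N}"
      then show "norm (\<gamma> (\<tau> (Suc i)) - \<gamma> (\<tau> i)) \<le> L * (\<tau> (Suc i) - \<tau> i)"
        using lipschitz_onD[OF assms ab[of "Suc i"] ab[of i]] u(4)[of i]
        by (simp add: dist_norm)
    qed
    also have "\<dots> = L * (b - a)"
      using sum_lessThan_telescope[of \<tau> N] u(2,3) by (simp flip: sum_distrib_left)
    finally show ?thesis .
  qed
  then show ?thesis by (auto simp: bdd_above_def)
qed

text \<open>The segment serves unless it meets 0; in that case it is bent into a parabola in a
  direction \<open>v\<close> orthogonal to it, which exists in dimension at least 2.\<close>

lemma rectifiable_arc_in_punctured_space:
  fixes x y :: "'a::euclidean_space"
  assumes dim: "2 \<le> DIM('a)" and "x \<noteq> 0" "y \<noteq> 0" "x \<noteq> y"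
  obtains \<gamma> where "rectifiable_arc \<gamma>" "path_image \<gamma> \<subseteq> punctured_space"
    "pathstart \<gamma> = x" "pathfinish \<gamma> = y"
proof -
  obtain v where v: "v \<noteq> 0" "(y - x) \<bullet> v = 0"
    using orthogonal_to_vector_exists[OF dim, of "y - x"] by (auto simp: orthogonal_def)
  define w where "w = (if 0 \<in> closed_segment x y then v else 0)"
  have w: "(y - x) \<bullet> w = 0" using v by (simp add: w_def)
  define \<gamma> where "\<gamma> t = x + t *\<^sub>R (y - x) + (t * (1 - t)) *\<^sub>R w" for t
  \<comment> \<open>Factoring out \<open>t - s\<close> gives both the Lipschitz bound and, after
    pairing with \<open>y - x\<close>, injectivity.\<close>
  have diff: "\<gamma> t - \<gamma> s = (t - s) *\<^sub>R ((y - x) + (1 - t - s) *\<^sub>R w)" for s t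
    by (simp add: \<gamma>_def algebra_simps)
  have "(norm (y - x) + norm w)-lipschitz_on {0..1} \<gamma>"
  proof (rule lipschitz_onI)
    fix t s :: real assume "t \<in> {0..1}" "s \<in> {0..1}"
    then have "\<bar>1 - t - s\<bar> * norm w \<le> 1 * norm w" by (intro mult_right_mono) auto
    then have "norm ((y - x) + (1 - t - s) *\<^sub>R w) \<le> norm (y - x) + norm w"
      using norm_triangle_ineq[of "y - x" "(1 - t - s) *\<^sub>R w"] by simp
    then show "dist (\<gamma> t) (\<gamma> s) \<le> (norm (y - x) + norm w) * dist t s"
      by (simp add: dist_norm diff mult.commute mult_right_mono mult_left_mono)
  qed simp
  moreover have "arc \<gamma>"
  proof -
    have "inj_on \<gamma> {0..1}"
    proof (rule inj_onI)
      fix t s assume "\<gamma> t = \<gamma> s"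
      then have "(y - x) \<bullet> (\<gamma> t - \<gamma> s) = 0" by simp
      then have "(t - s) * ((y - x) \<bullet> (y - x)) = 0"
        using w by (simp add: diff inner_add_right)
      then show "t = s" using \<open>x \<noteq> y\<close> by simp
    qed
    moreover have "continuous_on {0..1} \<gamma>"
      unfolding \<gamma>_def by (intro continuous_intros)
    ultimately show ?thesis by (simp add: arc_def path_def)
  qed
  ultimately have "rectifiable_arc \<gamma>"
    by (simp add: rectifiable_arc_def bdd_above_inscribed_lengths_lipschitz)
  moreover have "\<gamma> t \<noteq> 0" if t: "t \<in> {0..1}" for t
  proof
    assume 0: "\<gamma> t = 0"
    show False
    proof (cases "0 \<in> closed_segment x y")
      case False
      then have "(1 - t) *\<^sub>R x + t *\<^sub>R y = 0"
        using 0 by (simp add: \<gamma>_def w_def algebra_simps)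
      then show False using False t by (force simp: in_segment)
    next
      case True
      then obtain u where u: "(1 - u) *\<^sub>R x + u *\<^sub>R y = 0" by (auto simp: in_segment)
      \<comment> \<open>As 0 lies on the segment, \<open>x\<close> is parallel to
        \<open>y - x\<close> and so orthogonal to \<open>v\<close>. Only the bend contributes to
        \<open>\<gamma> t \<bullet> v\<close>, and it vanishes just at the endpoints.\<close>
      then have "x = - u *\<^sub>R (y - x)" by (simp add: algebra_simps add_eq_0_iff)
      then have "x \<bullet> v = (- u *\<^sub>R (y - x)) \<bullet> v" by (rule arg_cong)
      also have "\<dots> = 0" using v by simp
      finally have "x \<bullet> v = 0" .
      then have "\<gamma> t \<bullet> v = t * (1 - t) * (v \<bullet> v)"
        using v True by (simp add: \<gamma>_def w_def inner_add_left)
      then have "t = 0 \<or> t = 1" using 0 v by simp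
      then show False using 0 assms by (auto simp: \<gamma>_def)
    qed
  qed
  then have "path_image \<gamma> \<subseteq> punctured_space"
    by (auto simp: path_image_def punctured_space_def)
  ultimately show ?thesis
    using that[of \<gamma>] by (simp add: pathstart_def pathfinish_def \<gamma>_def)
qed

lemma quasihyperbolic_lower_bound:
  fixes x y :: "'a::euclidean_space"
  assumes "2 \<le> DIM('a)" "x \<noteq> 0" "y \<noteq> 0" "0 < d" "d \<le> norm (x - y)"
  shows "d / (norm x + d) \<le> quasihyperbolic x y"
proof -
  have "x \<noteq> y" using assms by auto
  moreover have "\<exists>\<gamma>. rectifiable_arc \<gamma> \<and> path_image \<gamma> \<subseteq> punctured_space \<and>
                         pathstart \<gamma> = x \<and> pathfinish \<gamma> = y"
    using rectifiable_arc_in_punctured_space[of x y] assms \<open>x \<noteq> y\<close> by metis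
  ultimately show ?thesis
    unfolding quasihyperbolic_def using assms
    by (auto intro!: cINF_greatest arclength_integral_lower_bound)
qed

section \<open>Best possible radii\<close>

text \<open>The quotient \<open>u / (a + u)\<close> equals \<open>1 - a / (a + u)\<close>, which
  increases with \<open>u\<close>.\<close>

lemma divide_add_self_mono:
  fixes a d u :: real
  assumes "0 < a" "0 \<le> d" "d \<le> u"
  shows "d / (a + d) \<le> u / (a + u)"
  using assms by (simp add: divide_simps algebra_simps mult_mono)

text \<open>For \<open>point_pair\<close>, \<open>chordal\<close> and \<open>triangular_ratio\<close>, bounding \<open>norm y\<close> by
  \<open>norm x + norm (x - y)\<close> leaves an increasing function of \<open>norm (x - y)\<close>.\<close>

lemma lower_bound_away_from_centre:
  fixes x :: "'a::euclidean_space"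
  assumes dim: "2 \<le> DIM('a)" and "x \<noteq> 0" "0 < d"
    and m: "m \<in> {distance_ratio, quasihyperbolic, dist, point_pair, chordal, triangular_ratio}"
  obtains t where "0 < t" "\<And>y. y \<noteq> 0 \<Longrightarrow> d \<le> norm (x - y) \<Longrightarrow> t \<le> m x y"
proof -
  have tri: "norm y \<le> norm x + norm (x - y)" for y
    using norm_triangle_sub[of y x] by (simp add: norm_minus_commute)
  have nx: "0 < norm x" using assms by simp
  consider "m = distance_ratio" | "m = quasihyperbolic" | "m = dist" | "m = point_pair" | "m = chordal"
    | "m = triangular_ratio" using m by auto
  then show ?thesis
  proof cases
    case 1
    have "ln (1 + d / norm x) \<le> m x y" if "y \<noteq> 0" "d \<le> norm (x - y)" for y
    proof -
      \<comment> \<open>The minimum is at most \<open>norm x\<close>, and it is positive because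
        \<open>y \<noteq> 0\<close>.\<close>
      have "d / norm x \<le> norm (x - y) / min (norm x) (norm y)"
        using that nx \<open>0 < d\<close> by (intro frac_le) auto
      moreover have "0 \<le> d / norm x" using nx \<open>0 < d\<close> by simp
      ultimately show ?thesis by (simp add: 1 distance_ratio_def)
    qed
    moreover have "0 < ln (1 + d / norm x)" using nx \<open>0 < d\<close> by (intro ln_gt_zero) simp
    ultimately show ?thesis using that by blast
  next
    case 2
    show ?thesis
      using that[of "d / (norm x + d)"] quasihyperbolic_lower_bound[OF dim \<open>x \<noteq> 0\<close>, of _ d] nx \<open>0 < d\<close>
      by (simp add: 2)
  next
    case 3
    show ?thesis using that[of d] \<open>0 < d\<close> by (simp add: 3 dist_norm)
  next
    case 4
    have "d / (2 * norm x + d) \<le> m x y" if "y \<noteq> 0" "d \<le> norm (x - y)" for y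
    proof -
      let ?D = "norm (x - y)"
      \<comment> \<open>Replacing \<open>norm y\<close> by \<open>norm x + ?D\<close> completes the
        square under the root.\<close>
      have "?D\<^sup>2 + 4 * norm x * norm y \<le> ?D\<^sup>2 + 4 * norm x * (norm x + ?D)"
        using tri[of y] by (intro add_left_mono mult_left_mono) auto
      also have "\<dots> = (2 * norm x + ?D)\<^sup>2" by (simp add: power2_eq_square algebra_simps)
      finally have "sqrt (?D\<^sup>2 + 4 * norm x * norm y) \<le> 2 * norm x + ?D"
        by (intro real_le_lsqrt) auto
      then have "?D / (2 * norm x + ?D) \<le> m x y"
        unfolding 4 point_pair_def using nx that(1)
        by (intro divide_left_mono mult_pos_pos add_pos_nonneg real_sqrt_gt_zero add_nonneg_pos) auto
      with divide_add_self_mono[of "2 * norm x" d ?D] nx that \<open>0 < d\<close> show ?thesis by simp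
    qed
    then show ?thesis using that[of "d / (2 * norm x + d)"] nx \<open>0 < d\<close> by simp
  next
    case 5
    let ?s = "sqrt (1 + (norm x)\<^sup>2)"
    have s: "0 < ?s" by (simp add: add_pos_nonneg)
    \<comment> \<open>The constant comes from bounding \<open>sqrt (1 + (norm y)\<^sup>2)\<close> by
      \<open>1 + norm y\<close> and then by \<open>1 + norm x + ?D\<close>.\<close>
    have "d / (1 + norm x + d) / ?s \<le> m x y" if "y \<noteq> 0" "d \<le> norm (x - y)" for y
    proof -
      let ?D = "norm (x - y)"
      have "sqrt (1 + (norm y)\<^sup>2) \<le> 1 + norm y"
        by (intro real_le_lsqrt) (auto simp: power2_eq_square algebra_simps)
      also have "\<dots> \<le> 1 + norm x + ?D" using tri[of y] by simp
      finally have "?D / (1 + norm x + ?D) \<le> ?D / sqrt (1 + (norm y)\<^sup>2)"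
        by (intro divide_left_mono) (auto intro!: mult_pos_pos add_pos_nonneg)
      moreover have "d / (1 + norm x + d) \<le> ?D / (1 + norm x + ?D)"
        using that \<open>0 < d\<close> by (intro divide_add_self_mono) (auto intro: add_pos_nonneg)
      ultimately have "d / (1 + norm x + d) / ?s \<le> ?D / sqrt (1 + (norm y)\<^sup>2) / ?s"
        using s by (intro divide_right_mono) auto
      then show ?thesis by (simp add: 5 chordal_def mult.commute)
    qed
    moreover have "0 < d / (1 + norm x + d) / ?s"
      using s nx \<open>0 < d\<close> by (intro divide_pos_pos add_pos_pos) auto
    ultimately show ?thesis using that by blast
  next
    case 6
    have "d / (2 * norm x + d) \<le> m x y" if "y \<noteq> 0" "d \<le> norm (x - y)" for y
    proof -
      let ?D = "norm (x - y)"
      have "?D / (2 * norm x + ?D) \<le> m x y"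
        unfolding 6 triangular_ratio_def using nx tri[of y]
        by (intro divide_left_mono) (auto intro!: mult_pos_pos add_pos_nonneg)
      with divide_add_self_mono[of "2 * norm x" d ?D] nx that \<open>0 < d\<close> show ?thesis by simp
    qed
    then show ?thesis using that[of "d / (2 * norm x + d)"] nx \<open>0 < d\<close> by simp
  qed
qed

theorem theorem1p3:
  fixes x :: "real ^ 'n" and r :: real
    and m :: "real ^ 'n \<Rightarrow> real ^ 'n \<Rightarrow> real"
  assumes "CARD('n) \<ge> 2"
    and "x \<in> punctured_space"
    and "0 < r" and "r \<le> pi"
    and "m \<in> {distance_ratio, quasihyperbolic, dist, point_pair, chordal, triangular_ratio}"
  shows "\<exists>t>0. m_ball m x t \<subseteq> m_ball visual_angle x r \<and>
           (\<forall>t'>t. \<not> m_ball m x t' \<subseteq> m_ball visual_angle x r)"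
proof -
  have "x \<noteq> 0" using assms(2) by (simp add: punctured_space_def)
  obtain d where d: "0 < d" "\<And>y. norm (x - y) < d \<Longrightarrow> visual_angle x y < r"
    using visual_angle_less_near[OF \<open>x \<noteq> 0\<close> assms(3,4)] by blast
  have "2 \<le> DIM(real ^ 'n)" using assms(1) by simp
  then obtain t0 where t0: "0 < t0" "\<And>y. y \<noteq> 0 \<Longrightarrow> d \<le> norm (x - y) \<Longrightarrow> t0 \<le> m x y"
    using lower_bound_away_from_centre[OF _ \<open>x \<noteq> 0\<close> d(1) assms(5)] by blast
  define S where "S = {t. m_ball m x t \<subseteq> m_ball visual_angle x r}"
  \<comment> \<open>Contraposition of the bound: \<open>m x y < t0\<close> forces
    \<open>norm (x - y) < d\<close>, hence an angle below \<open>r\<close>.\<close>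
  have "t0 \<in> S"
    using t0(2) d(2) unfolding S_def m_ball_def punctured_space_def by fastforce
  \<comment> \<open>A larger radius would admit \<open>- x\<close>, whose visual angle
    \<open>pi\<close> is not below \<open>r\<close>.\<close>
  have "t \<le> m x (- x)" if "t \<in> S" for t
  proof (rule ccontr)
    assume "\<not> t \<le> m x (- x)"
    then have "- x \<in> m_ball m x t" using \<open>x \<noteq> 0\<close> by (simp add: m_ball_def punctured_space_def)
    then have "- x \<in> m_ball visual_angle x r" using that by (auto simp: S_def)
    then show False using visual_angle_minus[OF \<open>x \<noteq> 0\<close>] assms(4) by (simp add: m_ball_def)
  qed
  then have "bdd_above S" by (auto simp: bdd_above_def)
  have "m_ball m x (Sup S) \<subseteq> m_ball visual_angle x r"
  proof
    fix y assume y: "y \<in> m_ball m x (Sup S)"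
    then have "m x y < Sup S" by (simp add: m_ball_def)
    then obtain t where "t \<in> S" "m x y < t"
      using less_cSup_iff[of S] \<open>t0 \<in> S\<close> \<open>bdd_above S\<close> by blast
    then show "y \<in> m_ball visual_angle x r" using y by (auto simp: S_def m_ball_def)
  qed
  then have "Sup S \<in> S" by (simp add: S_def)
  moreover have "0 < Sup S"
    using cSup_upper[OF \<open>t0 \<in> S\<close> \<open>bdd_above S\<close>] t0(1) by linarith
  moreover have "t' \<notin> S" if "Sup S < t'" for t'
    using cSup_upper[of t' S] \<open>bdd_above S\<close> that by force
  ultimately show ?thesis by (auto simp: S_def)
qed

end
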